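(* Let $c \ge 3$ be a constant. There exists no deterministic algorithm that, for all partial orders $P$ on an $n$-element ground set $X$, can preprocess $P$ using at most $\frac{1}{48} n^{1+\frac{1}{c}}$ partial oracle queries such that, afterwards, given the linear oracle $O_L$ of any linear extension $L$ of $P$, it can recover the linear order $L$ on $X$ using at most $\frac{1}{73} c \log e(P)$ exact (linear) oracle queries.
   Context: A partial oracle $O_P$ answers, for any ordered pair $(x_i,x_j)$ of distinct elements of $X$, whether $x_i \prec_P x_j$. A linear (exact) oracle $O_L$ answers, for any pair $(x_i,x_j)$, whether $x_i <_L x_j$, where $L$ is a linear order extending $P$ (i.e. $x_i <_L x_j$ whenever $x_i \prec_P x_j$). The algorithm has a preprocessing phase that only accesses $O_P$, followed by a query phase that accesses $O_L$. $e(P)$ denotes the number of linear extensions of $P$ and $\log$ is base $2$. *)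

theory Defs
  imports Complex_Main
begin

text \<open>
  A deterministic adaptive query algorithm over elements of type \<open>'a\<close> is a finite binary decision
  tree: \<open>Query x y t f\<close> asks whether the relation \<open>orc\<close> holds of \<open>(x, y)\<close> and continues with \<open>t\<close> on
  the answer yes and with \<open>f\<close> on the answer no. No uniformity or running time restriction is
  imposed, only queries are counted.
\<close>

datatype ('a, outputs: 'r) query_alg =
    Return 'r
  | Query 'a 'a "('a, 'r) query_alg" "('a, 'r) query_alg"

primrec run :: "('a \<Rightarrow> 'a \<Rightarrow> bool) \<Rightarrow> ('a, 'r) query_alg \<Rightarrow> 'r" where
  "run orc (Return r) = r"
| "run orc (Query x y t f) = (if orc x y then run orc t else run orc f)"

primrec num_queries :: "('a \<Rightarrow> 'a \<Rightarrow> bool) \<Rightarrow> ('a, 'r) query_alg \<Rightarrow> nat" where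
  "num_queries orc (Return r) = 0"
| "num_queries orc (Query x y t f) =
     Suc (if orc x y then num_queries orc t else num_queries orc f)"

primrec queries_in :: "'a set \<Rightarrow> ('a, 'r) query_alg \<Rightarrow> bool" where
  "queries_in X (Return r) \<longleftrightarrow> True"
| "queries_in X (Query x y t f) \<longleftrightarrow>
     x \<in> X \<and> y \<in> X \<and> x \<noteq> y \<and> queries_in X t \<and> queries_in X f"

text \<open>
  Orders are reflexive relations, as in \<open>partial_order_on\<close> and \<open>linear_order_on\<close>; the answers given for
  an order concern its strict part. For reflexive \<open>P\<close> and \<open>L\<close> on the same set,
  \<open>P \<subseteq> L\<close> says exactly that \<open>x \<prec> y\<close> in \<open>P\<close> implies \<open>x < y\<close> in \<open>L\<close>.
\<close>

definition strict_oracle :: "'a rel \<Rightarrow> 'a \<Rightarrow> 'a \<Rightarrow> bool" where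
  "strict_oracle R x y \<longleftrightarrow> (x, y) \<in> R \<and> x \<noteq> y"

definition linear_extensions :: "'a set \<Rightarrow> 'a rel \<Rightarrow> 'a rel set" where
  "linear_extensions X P = {L. linear_order_on X L \<and> P \<subseteq> L}"

definition num_linear_extensions :: "'a set \<Rightarrow> 'a rel \<Rightarrow> nat" where
  "num_linear_extensions X P = card (linear_extensions X P)"

text \<open>
  The preprocessing phase is a query algorithm whose output is itself a query algorithm, namely
  the one to be run in the query phase. The query phase may thus use everything learned during
  preprocessing, but depends on the partial order in no other way.
\<close>

type_synonym 'a two_phase_alg = "('a, ('a, 'a rel) query_alg) query_alg"

definition valid_alg :: "'a set \<Rightarrow> 'a two_phase_alg \<Rightarrow> bool" where
  "valid_alg X A \<longleftrightarrow> queries_in X A \<and> (\<forall>B \<in> outputs A. queries_in X B)"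

end

theory Submission
  imports Defs
begin

text \<open>
  Put \<open>a = n powr (1 / c)\<close>. If \<open>P\<close> is a chain then \<open>log e(P) = 0\<close>, so the query phase is empty and
  preprocessing alone must sort; this needs \<open>log n!\<close> queries, too many when \<open>a < 3\<close>. If \<open>a \<ge> 3\<close>,
  answer no to every partial query. The queried pairs form a graph which is coloured greedily, a
  vertex \<open>v\<close> getting a colour at most \<open>deg v\<close>. Any linear order \<open>L\<close>, restricted to pairs of equal
  colour, gives a partial order \<open>P\<close> consistent with these answers, so one fixed query phase sorts all
  \<open>n!\<close> orders. Giving colour \<open>j\<close> the weight \<open>1 / ((j + 1) (j + 2))\<close>, of total mass at most \<open>1\<close>, one
  gets \<open>e(P) \<le> (\<Prod>v. (deg v + 2)\<^sup>2)\<close>, hence \<open>log e(P) \<le> 2 n log a\<close> by concavity of the logarithm.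
  The query phase thus makes at most \<open>2 / 73 n log n\<close> queries, fewer than \<open>log n!\<close>
  since \<open>n ^ n \<le> (n!)\<^sup>2\<close>.
\<close>

section \<open>Decision trees\<close>

text \<open>Each query splits the oracles by their answer, so depth \<open>D\<close> allows at most
  \<open>2 ^ D\<close> outputs. The bound on the depth concerns only oracles in \<open>S\<close>;
  branches that none of them reaches may be deeper.\<close>

lemma card_run_image_le:
  assumes "\<And>orc. orc \<in> S \<Longrightarrow> num_queries orc B \<le> D"
  shows "finite ((\<lambda>orc. run orc B) ` S) \<and> card ((\<lambda>orc. run orc B) ` S) \<le> 2 ^ D"
  using assms
proof (induction B arbitrary: S D)
  case (Return r)
  have sub: "(\<lambda>orc. run orc (Return r)) ` S \<subseteq> {r}" by auto
  have "card ((\<lambda>orc. run orc (Return r)) ` S) \<le> card {r}" by (rule card_mono[OF _ sub]) simp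
  also have "\<dots> \<le> 2 ^ D" by simp
  finally show ?case using finite_subset[OF sub] by blast
next
  case (Query x y t f)
  show ?case
  proof (cases D)
    case 0
    \<comment> \<open>A query node costs at least one query, so no oracle meets the bound
      \<open>0\<close>.\<close>
    then have "S = {}" using Query.prems by fastforce
    then show ?thesis by simp
  next
    case (Suc D')
    let ?T = "{orc \<in> S. orc x y}" and ?F = "{orc \<in> S. \<not> orc x y}"
    have T: "finite ((\<lambda>orc. run orc t) ` ?T) \<and> card ((\<lambda>orc. run orc t) ` ?T) \<le> 2 ^ D'"
      by (rule Query.IH(1)) (use Query.prems Suc in force)
    have F: "finite ((\<lambda>orc. run orc f) ` ?F) \<and> card ((\<lambda>orc. run orc f) ` ?F) \<le> 2 ^ D'"
      by (rule Query.IH(2)) (use Query.prems Suc in force)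
    have eq: "(\<lambda>orc. run orc (Query x y t f)) ` S
        = (\<lambda>orc. run orc t) ` ?T \<union> (\<lambda>orc. run orc f) ` ?F"
      by auto
    show ?thesis
      unfolding eq using T F Suc
        card_Un_le[of "(\<lambda>orc. run orc t) ` ?T" "(\<lambda>orc. run orc f) ` ?F"] by auto
  qed
qed

text \<open>The edges of the graph that the adversary colours. Being a set, it counts a repeated
  query once.\<close>

primrec all_no_queries :: "('a, 'r) query_alg \<Rightarrow> 'a rel" where
  "all_no_queries (Return r) = {}"
| "all_no_queries (Query x y t f) = insert (x, y) (all_no_queries f)"

lemma finite_all_no_queries: "finite (all_no_queries A)"
  by (induction A) auto

lemma card_all_no_queries: "card (all_no_queries A) \<le> num_queries (\<lambda>_ _. False) A"
  by (induction A) (auto simp: card_insert_if finite_all_no_queries)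

text \<open>An oracle that denies the pairs on the all-no path follows that very path, whatever it
  says about other pairs. Hence preprocessing cannot tell the adversary's orders apart.\<close>

lemma run_all_no:
  assumes "\<And>x y. (x, y) \<in> all_no_queries A \<Longrightarrow> \<not> orc x y"
  shows "run orc A = run (\<lambda>_ _. False) A"
    and "num_queries orc A = num_queries (\<lambda>_ _. False) A"
  using assms by (induction A) auto

section \<open>Linear orders on finite sets\<close>

lemma linear_order_on_iff:
  "linear_order_on X L \<longleftrightarrow> L \<subseteq> X \<times> X \<and> (\<forall>x\<in>X. (x, x) \<in> L) \<and>
     (\<forall>x y z. (x, y) \<in> L \<longrightarrow> (y, z) \<in> L \<longrightarrow> (x, z) \<in> L) \<and>
     (\<forall>x y. (x, y) \<in> L \<longrightarrow> (y, x) \<in> L \<longrightarrow> x = y) \<and>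
     (\<forall>x\<in>X. \<forall>y\<in>X. (x, y) \<in> L \<or> (y, x) \<in> L)"
proof -
  have "refl_on X L \<Longrightarrow> total_on X L \<longleftrightarrow> (\<forall>x\<in>X. \<forall>y\<in>X. (x, y) \<in> L \<or> (y, x) \<in> L)"
    unfolding refl_on_def total_on_def by metis
  then show ?thesis
    unfolding order_on_defs refl_on_def antisym_def trans_def by argo
qed

lemma linear_order_on_subset: "linear_order_on X L \<Longrightarrow> L \<subseteq> X \<times> X"
  by (simp add: linear_order_on_iff)

lemma linear_order_on_refl: "linear_order_on X L \<Longrightarrow> x \<in> X \<Longrightarrow> (x, x) \<in> L"
  by (simp add: linear_order_on_iff)

lemma linear_order_on_trans:
  "linear_order_on X L \<Longrightarrow> (x, y) \<in> L \<Longrightarrow> (y, z) \<in> L \<Longrightarrow> (x, z) \<in> L"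
  unfolding linear_order_on_iff by metis

lemma linear_order_on_antisym:
  "linear_order_on X L \<Longrightarrow> (x, y) \<in> L \<Longrightarrow> (y, x) \<in> L \<Longrightarrow> x = y"
  unfolding linear_order_on_iff by metis

lemma linear_order_on_total:
  "linear_order_on X L \<Longrightarrow> x \<in> X \<Longrightarrow> y \<in> X \<Longrightarrow> (x, y) \<in> L \<or> (y, x) \<in> L"
  by (simp add: linear_order_on_iff)

lemma linear_order_on_has_top:
  assumes "finite X" "X \<noteq> {}" "linear_order_on X L"
  shows "\<exists>m\<in>X. \<forall>x\<in>X. (x, m) \<in> L"
proof -
  \<comment> \<open>The induction runs over subsets \<open>Y\<close> with \<open>L\<close> fixed,
    which avoids restricting \<open>L\<close>.\<close>
  have "\<exists>m\<in>Y. \<forall>x\<in>Y. (x, m) \<in> L" if "finite Y" "Y \<noteq> {}" "Y \<subseteq> X" for Y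
    using that
  proof (induction Y rule: finite_ne_induct)
    case (singleton x)
    then show ?case using assms(3) by (auto simp: linear_order_on_iff)
  next
    case (insert x F)
    then obtain m where "m \<in> F" "\<forall>z\<in>F. (z, m) \<in> L" by auto
    then show ?case using assms(3) insert.prems unfolding linear_order_on_iff
      by (metis insert_iff subsetD)
  qed
  then show ?thesis using assms by simp
qed

lemma linear_order_on_add_top:
  assumes "linear_order_on Y L" "m \<notin> Y"
  shows "linear_order_on (insert m Y) (L \<union> insert m Y \<times> {m})"
proof -
  have sub: "x \<in> Y" "y \<in> Y" if "(x, y) \<in> L" for x y
    using linear_order_on_subset[OF assms(1)] that by auto
  show ?thesis
    unfolding linear_order_on_iff
    using sub assms(2) linear_order_on_trans[OF assms(1)] linear_order_on_antisym[OF assms(1)]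
      linear_order_on_total[OF assms(1)] linear_order_on_refl[OF assms(1)]
    by (intro conjI ballI allI impI) (simp_all, safe, metis+)
qed

lemma linear_order_on_remove:
  assumes "linear_order_on X L"
  shows "linear_order_on (X - {m}) (L \<inter> (X - {m}) \<times> (X - {m}))"
  unfolding linear_order_on_iff
proof (intro conjI)
  show "\<forall>x\<in>X - {m}. (x, x) \<in> L \<inter> (X - {m}) \<times> (X - {m})"
    using assms unfolding linear_order_on_iff by simp
  show "\<forall>x y z. (x, y) \<in> L \<inter> (X - {m}) \<times> (X - {m}) \<longrightarrow> (y, z) \<in> L \<inter> (X - {m}) \<times> (X - {m})
      \<longrightarrow> (x, z) \<in> L \<inter> (X - {m}) \<times> (X - {m})"
    using assms unfolding linear_order_on_iff by (metis IntE IntI mem_Sigma_iff)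
  show "\<forall>x y. (x, y) \<in> L \<inter> (X - {m}) \<times> (X - {m}) \<longrightarrow> (y, x) \<in> L \<inter> (X - {m}) \<times> (X - {m})
      \<longrightarrow> x = y"
    using assms unfolding linear_order_on_iff by (metis IntE)
  show "\<forall>x\<in>X - {m}. \<forall>y\<in>X - {m}. (x, y) \<in> L \<inter> (X - {m}) \<times> (X - {m})
      \<or> (y, x) \<in> L \<inter> (X - {m}) \<times> (X - {m})"
    using assms unfolding linear_order_on_iff by simp
qed blast

lemma linear_order_on_top_decomp:
  assumes "linear_order_on X L" "m \<in> X" "\<forall>x\<in>X. (x, m) \<in> L"
  shows "L = (L \<inter> (X - {m}) \<times> (X - {m})) \<union> X \<times> {m}"
proof -
  have "L \<subseteq> X \<times> X" "\<forall>x. (m, x) \<in> L \<longrightarrow> x = m"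
    using assms unfolding linear_order_on_iff by (metis, metis mem_Sigma_iff subsetD)
  then show ?thesis using assms(3) by blast
qed

lemma finite_linear_orders: "finite X \<Longrightarrow> finite {L. linear_order_on X L}"
  by (rule finite_subset[of _ "Pow (X \<times> X)"]) (auto simp: linear_order_on_iff)

text \<open>Choosing a top element \<open>m\<close> and a linear order of the rest determines
  distinct linear orders, so the count grows at least by the factor \<open>card X\<close>.\<close>

lemma fact_le_card_linear_orders:
  "finite X \<Longrightarrow> fact (card X) \<le> card {L. linear_order_on X L}"
proof (induction "card X" arbitrary: X)
  case 0
  then have "{} \<in> {L. linear_order_on X L}" by (auto simp: linear_order_on_iff)
  then have "card {L. linear_order_on X L} \<noteq> 0"
    using finite_linear_orders[OF 0(2)] by auto
  then show ?case using 0 by simp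
next
  case (Suc k)
  define S where "S = (SIGMA m:X. {L. linear_order_on (X - {m}) L})"
  define g where "g = (\<lambda>(m, L). L \<union> X \<times> {m::'a})"
  have "inj_on g S"
  proof (rule inj_onI, clarify)
    fix m L m' L'
    assume S: "(m, L) \<in> S" "(m', L') \<in> S" and eq: "g (m, L) = g (m', L')"
    have *: "L \<union> X \<times> {m} = L' \<union> X \<times> {m'}" using eq by (simp add: g_def)
    have sub: "L \<subseteq> (X - {m}) \<times> (X - {m})" "L' \<subseteq> (X - {m'}) \<times> (X - {m'})" "m \<in> X" "m' \<in> X"
      using S by (auto simp: S_def linear_order_on_iff)
    \<comment> \<open>The top can be read off the order: \<open>L'\<close> has no pair involving
      \<open>m'\<close>, so this pair lies in \<open>X \<times> {m'}\<close>.\<close>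
    have "(m', m) \<in> L' \<union> X \<times> {m'}" using * sub by blast
    then have "m = m'" using sub by auto
    with * sub show "m = m' \<and> L = L'" by blast
  qed
  moreover have "g ` S \<subseteq> {L. linear_order_on X L}"
  proof clarify
    fix m L assume "(m, L) \<in> S"
    then have "m \<in> X" "linear_order_on (X - {m}) L" by (auto simp: S_def)
    with linear_order_on_add_top[of "X - {m}" L m] show "linear_order_on X (g (m, L))"
      by (simp add: g_def insert_absorb)
  qed
  ultimately have "card S \<le> card {L. linear_order_on X L}"
    using card_inj_on_le finite_linear_orders[OF Suc.prems] by blast
  moreover have "card S = (\<Sum>m\<in>X. card {L. linear_order_on (X - {m}) L})"
    unfolding S_def using Suc.prems by (auto intro!: card_SigmaI finite_linear_orders)
  moreover have "(\<Sum>m\<in>X. fact k) \<le> (\<Sum>m\<in>X. card {L. linear_order_on (X - {m}) L})"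
  proof (rule sum_mono)
    fix m assume "m \<in> X"
    then have "k = card (X - {m})" using Suc by simp
    from Suc.hyps(1)[OF this] Suc.prems this
    show "fact k \<le> card {L. linear_order_on (X - {m}) L}" by simp
  qed
  ultimately show ?case using Suc.hyps(2)[symmetric] by simp
qed

text \<open>For a chain the query budget is thus \<open>log 2 1 = 0\<close>, and preprocessing has
  to do all the sorting.\<close>

lemma linear_extensions_linear_order:
  assumes "linear_order_on X L"
  shows "linear_extensions X L = {L}"
proof -
  have "M = L" if M: "linear_order_on X M" "L \<subseteq> M" for M
    using linear_order_on_subset[OF M(1)] linear_order_on_antisym[OF M(1)]
      linear_order_on_total[OF assms] M(2) linear_order_on_refl[OF assms] by fast
  then show ?thesis using assms by (auto simp: linear_extensions_def)
qed

text \<open>The information-theoretic sorting bound. The decoder \<open>g\<close> admits trees whose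
  output is not itself an order but determines one.\<close>

lemma fact_le_of_sorting:
  assumes "finite X"
    and "\<And>L. linear_order_on X L \<Longrightarrow> g (run (strict_oracle L) B) = L"
    and "\<And>L. linear_order_on X L \<Longrightarrow> num_queries (strict_oracle L) B \<le> D"
  shows "fact (card X) \<le> (2::nat) ^ D"
proof -
  let ?O = "{L. linear_order_on X L}"
  let ?R = "(\<lambda>orc. run orc B) ` strict_oracle ` ?O"
  have R: "finite ?R \<and> card ?R \<le> 2 ^ D"
    by (rule card_run_image_le) (use assms(3) in auto)
  have "?O \<subseteq> g ` ?R" using assms(2) by (force simp: image_iff)
  then have "card ?O \<le> card ?R" using R surj_card_le by blast
  then show ?thesis using R fact_le_card_linear_orders[OF assms(1)] by linarith
qed

section \<open>Linear extensions of unions of chains\<close>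

text \<open>The weight of \<open>j\<close> is \<open>1 / (j + 1) - 1 / (j + 2)\<close>, so initial
  sums telescope.\<close>

lemma sum_colour_weights_le_1:
  assumes "finite (J :: nat set)"
  shows "(\<Sum>j\<in>J. 1 / ((real j + 1) * (real j + 2))) \<le> 1"
proof -
  have *: "(\<Sum>j<k. 1 / ((real j + 1) * (real j + 2))) = 1 - 1 / (real k + 1)" for k
  proof (induction k)
    case (Suc k)
    have "1 / ((real k + 1) * (real k + 2)) = 1 / (real k + 1) - 1 / (real k + 2)"
      by (simp add: field_simps)
    with Suc show ?case by (simp add: add.commute)
  qed simp
  obtain k where "J \<subseteq> {..<k}" using assms by (auto simp: finite_nat_set_iff_bounded)
  then have "(\<Sum>j\<in>J. 1 / ((real j + 1) * (real j + 2)))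
      \<le> (\<Sum>j<k. 1 / ((real j + 1) * (real j + 2)))"
    by (intro sum_mono2) auto
  also have "\<dots> \<le> 1" unfolding * by simp
  finally show ?thesis .
qed

text \<open>For a linear order \<open>L0\<close>, these are the linear extensions of the disjoint
  union of its colour classes taken as chains. \<open>L0\<close> may be any relation, so it can stay
  fixed while \<open>X\<close> shrinks.\<close>

definition agreeing_orders :: "'a set \<Rightarrow> ('a \<Rightarrow> nat) \<Rightarrow> 'a rel \<Rightarrow> 'a rel set" where
  "agreeing_orders X f L0 = {L. linear_order_on X L \<and>
     (\<forall>x\<in>X. \<forall>y\<in>X. f x = f y \<longrightarrow> ((x, y) \<in> L \<longleftrightarrow> (x, y) \<in> L0))}"

text \<open>Induction by deleting the top element \<open>m\<close>: the orders with top
  \<open>m\<close> number at most the product without the factor of \<open>m\<close>. Possible tops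
  have distinct colours, so the reciprocals of the missing factors sum to at most 1.\<close>

lemma card_agreeing_orders_le:
  assumes "finite X"
  shows "real (card (agreeing_orders X f L0)) \<le> (\<Prod>v\<in>X. (real (f v) + 1) * (real (f v) + 2))"
  using assms
proof (induction "card X" arbitrary: X)
  case 0
  then have "agreeing_orders X f L0 \<subseteq> {{}}"
    by (auto simp: agreeing_orders_def linear_order_on_iff)
  then have "card (agreeing_orders X f L0) \<le> card {{}::'a rel}" by (intro card_mono) auto
  then show ?case using 0 by simp
next
  case (Suc k)
  let ?w = "\<lambda>j. (real j + 1) * (real j + 2)"
  let ?A = "\<lambda>X. agreeing_orders X f L0"
  \<comment> \<open>The agreement with \<open>L0\<close> leaves only one candidate of each colour for the top element.\<close>
  define top where "top m L \<longleftrightarrow> (\<forall>x\<in>X. (x, m) \<in> L)" for m and L :: "'a rel"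
  define T where "T = {m \<in> X. \<exists>L\<in>?A X. top m L}"
  have fin: "finite (?A Y)" if "finite Y" for Y
    by (rule finite_subset[OF _ finite_linear_orders[OF that]]) (auto simp: agreeing_orders_def)
  have "finite T" using Suc.prems by (simp add: T_def)
  have inj: "inj_on f T"
  proof (rule inj_onI)
    fix m m' assume "m \<in> T" "m' \<in> T" and eq: "f m = f m'"
    then obtain L L' where L: "L \<in> ?A X" "top m L" "L' \<in> ?A X" "top m' L'"
      and m: "m \<in> X" "m' \<in> X" by (auto simp: T_def)
    have "(m', m) \<in> L" using L m by (simp add: top_def)
    then have "(m', m) \<in> L'" using L m eq by (auto simp: agreeing_orders_def)
    moreover have "(m, m') \<in> L'" using L m by (simp add: top_def)
    ultimately show "m = m'" using L linear_order_on_antisym by (auto simp: agreeing_orders_def)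
  qed
  have cover: "?A X \<subseteq> (\<Union>m\<in>T. {L \<in> ?A X. top m L})"
  proof
    fix L assume L: "L \<in> ?A X"
    have "X \<noteq> {}" using Suc.hyps by auto
    then obtain m where "m \<in> X" "top m L"
      using linear_order_on_has_top[of X L] L Suc.prems
      by (auto simp: top_def agreeing_orders_def)
    then show "L \<in> (\<Union>m\<in>T. {L \<in> ?A X. top m L})" using L by (auto simp: T_def)
  qed
  have step: "real (card {L \<in> ?A X. top m L}) \<le> (1 / ?w (f m)) * (\<Prod>v\<in>X. ?w (f v))"
    if "m \<in> T" for m
  proof -
    have m: "m \<in> X" using that by (simp add: T_def)
    let ?r = "\<lambda>L. L \<inter> (X - {m}) \<times> (X - {m})"
    have "inj_on ?r {L \<in> ?A X. top m L}"
    proof (rule inj_onI)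
      fix L L' assume L: "L \<in> {L \<in> ?A X. top m L}" and L': "L' \<in> {L \<in> ?A X. top m L}"
        and eq: "?r L = ?r L'"
      have "L = ?r L \<union> X \<times> {m}"
        using linear_order_on_top_decomp[of X L m] L m by (auto simp: top_def agreeing_orders_def)
      moreover have "L' = ?r L' \<union> X \<times> {m}"
        using linear_order_on_top_decomp[of X L' m] L' m by (auto simp: top_def agreeing_orders_def)
      ultimately show "L = L'" using eq by simp
    qed
    moreover have "?r ` {L \<in> ?A X. top m L} \<subseteq> ?A (X - {m})"
      using linear_order_on_remove[of X _ m] by (auto simp: agreeing_orders_def)
    ultimately have "card {L \<in> ?A X. top m L} \<le> card (?A (X - {m}))"
      by (rule card_inj_on_le) (simp add: fin Suc.prems)
    moreover have "real (card (?A (X - {m}))) \<le> (\<Prod>v\<in>X - {m}. ?w (f v))"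
      using Suc.hyps(1)[of "X - {m}"] Suc.hyps(2) Suc.prems m by simp
    moreover have "(\<Prod>v\<in>X. ?w (f v)) = ?w (f m) * (\<Prod>v\<in>X - {m}. ?w (f v))"
      using Suc.prems m by (rule prod.remove)
    moreover have "?w (f m) > 0" by (simp add: add_pos_pos)
    ultimately show ?thesis by simp
  qed
  have "card (?A X) \<le> card (\<Union>m\<in>T. {L \<in> ?A X. top m L})"
    using cover by (intro card_mono) (auto simp: \<open>finite T\<close> fin Suc.prems)
  also have "\<dots> \<le> (\<Sum>m\<in>T. card {L \<in> ?A X. top m L})" by (rule card_UN_le[OF \<open>finite T\<close>])
  finally have "real (card (?A X)) \<le> (\<Sum>m\<in>T. real (card {L \<in> ?A X. top m L}))"
    unfolding of_nat_sum[symmetric] of_nat_le_iff .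
  also have "\<dots> \<le> (\<Sum>m\<in>T. (1 / ?w (f m)) * (\<Prod>v\<in>X. ?w (f v)))" by (rule sum_mono[OF step])
  also have "\<dots> = (\<Sum>m\<in>T. 1 / ?w (f m)) * (\<Prod>v\<in>X. ?w (f v))" by (rule sum_distrib_right[symmetric])
  \<comment> \<open>Distinct colours turn the sum over tops into a sum over a set of
    colours.\<close>
  also have "(\<Sum>m\<in>T. 1 / ?w (f m)) = (\<Sum>j\<in>f ` T. 1 / ?w j)" by (simp add: sum.reindex[OF inj])
  also have "\<dots> * (\<Prod>v\<in>X. ?w (f v)) \<le> 1 * (\<Prod>v\<in>X. ?w (f v))"
    using sum_colour_weights_le_1[of "f ` T"] \<open>finite T\<close>
    by (intro mult_right_mono prod_nonneg) auto
  finally show ?case by simp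
qed

text \<open>The adversary's partial order: one chain per colour, with different colours
  incomparable.\<close>

definition monochromatic_part :: "('a \<Rightarrow> nat) \<Rightarrow> 'a rel \<Rightarrow> 'a rel" where
  "monochromatic_part f L = {(x, y) \<in> L. f x = f y}"

lemma partial_order_on_monochromatic_part:
  assumes "linear_order_on X L"
  shows "partial_order_on X (monochromatic_part f L)"
  unfolding order_on_defs refl_on_def antisym_def trans_def monochromatic_part_def
  using linear_order_on_subset[OF assms] linear_order_on_refl[OF assms]
    linear_order_on_trans[OF assms] linear_order_on_antisym[OF assms]
  by auto

text \<open>On a pair of equal colour, totality of \<open>L\<close> puts one direction into every
  extension, and antisymmetry excludes the other.\<close>

lemma linear_extensions_monochromatic_part:
  assumes "linear_order_on X L"
  shows "linear_extensions X (monochromatic_part f L) = agreeing_orders X f L"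
proof -
  have "monochromatic_part f L \<subseteq> M \<longleftrightarrow>
      (\<forall>x\<in>X. \<forall>y\<in>X. f x = f y \<longrightarrow> ((x, y) \<in> M \<longleftrightarrow> (x, y) \<in> L))" (is "?l \<longleftrightarrow> ?r")
    if M: "linear_order_on X M" for M
  proof
    assume l: ?l
    show ?r
    proof (intro ballI impI)
      fix x y assume xy: "x \<in> X" "y \<in> X" "f x = f y"
      have "(x, y) \<in> L \<Longrightarrow> (x, y) \<in> M" "(y, x) \<in> L \<Longrightarrow> (y, x) \<in> M"
        using l xy(3) by (auto simp: monochromatic_part_def)
      then show "(x, y) \<in> M \<longleftrightarrow> (x, y) \<in> L"
        using linear_order_on_antisym[OF M] linear_order_on_total[OF assms xy(1,2)] by blast
    qed
  next
    assume ?r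
    then show ?l using linear_order_on_subset[OF assms] by (auto simp: monochromatic_part_def)
  qed
  then show ?thesis by (auto simp: linear_extensions_def agreeing_orders_def)
qed

section \<open>Greedy colouring\<close>

text \<open>Its cardinality serves as the degree of \<open>v\<close>; the two orientations of a pair
  count separately.\<close>

definition incident :: "'a rel \<Rightarrow> 'a \<Rightarrow> 'a rel" where
  "incident E v = {e \<in> E. fst e = v \<or> snd e = v}"

text \<open>When \<open>v\<close> is inserted, its incident pairs forbid at most
  \<open>deg v\<close> of the colours \<open>0, ..., deg v\<close>, so one remains free.\<close>

lemma greedy_colouring:
  assumes "finite E" "finite X"
  shows "\<exists>f :: 'a \<Rightarrow> nat. (\<forall>v\<in>X. f v \<le> card (incident E v)) \<and>
    (\<forall>x\<in>X. \<forall>y\<in>X. (x, y) \<in> E \<longrightarrow> x \<noteq> y \<longrightarrow> f x \<noteq> f y)"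
  using assms(2)
proof (induction X rule: finite_induct)
  case empty
  then show ?case by simp
next
  case (insert v X)
  then obtain f where f: "\<forall>v\<in>X. f v \<le> card (incident E v)"
    "\<forall>x\<in>X. \<forall>y\<in>X. (x, y) \<in> E \<longrightarrow> x \<noteq> y \<longrightarrow> f x \<noteq> (f y :: nat)" by blast
  let ?U = "(\<lambda>e. f (if fst e = v then snd e else fst e)) ` incident E v"
  have fin: "finite (incident E v)" using assms(1) by (simp add: incident_def)
  have "card ?U < card {..card (incident E v)}"
    using card_image_le[OF fin] unfolding card_atMost less_Suc_eq_le .
  then have "\<not> {..card (incident E v)} \<subseteq> ?U"
    using card_mono[of ?U "{..card (incident E v)}"] fin by auto
  then obtain j where j: "j \<le> card (incident E v)" "j \<notin> ?U" by auto
  have out: "f y \<noteq> j" if "(v, y) \<in> E" for y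
    using j(2) that by (force simp: incident_def image_iff)
  have inn: "f y \<noteq> j" if "(y, v) \<in> E" "y \<noteq> v" for y
    using j(2) that by (force simp: incident_def image_iff)
  show ?case
    by (rule exI[of _ "f(v := j)"]) (use f j(1) out inn insert.hyps in \<open>auto dest: sym[of j]\<close>)
qed

text \<open>Double counting: a pair is incident to at most its two endpoints.\<close>

lemma sum_card_incident_le:
  assumes "finite E" "finite X"
  shows "(\<Sum>v\<in>X. card (incident E v)) \<le> 2 * card E"
proof -
  have "(\<Sum>v\<in>X. card (incident E v)) = (\<Sum>v\<in>X. \<Sum>e\<in>E. if fst e = v \<or> snd e = v then 1 else 0)"
    by (simp only: incident_def card_eq_sum sum.inter_filter[OF assms(1)])
  also have "\<dots> = (\<Sum>e\<in>E. \<Sum>v\<in>X. if fst e = v \<or> snd e = v then 1 else 0)" by (rule sum.swap)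
  also have "\<dots> \<le> (\<Sum>e\<in>E. 2)"
  proof (rule sum_mono)
    fix e :: "'a \<times> 'a"
    have "(\<Sum>v\<in>X. if fst e = v \<or> snd e = v then 1 else 0) = card {v \<in> X. fst e = v \<or> snd e = v}"
      by (simp only: card_eq_sum sum.inter_filter[OF assms(2)])
    also have "\<dots> \<le> card {fst e, snd e}" by (rule card_mono) auto
    also have "\<dots> \<le> 2" by (simp add: card_insert_if)
    finally show "(\<Sum>v\<in>X. if fst e = v \<or> snd e = v then 1 else 0) \<le> (2::nat)" .
  qed
  finally show ?thesis by simp
qed

section \<open>Estimates\<close>

text \<open>Jensen's inequality for \<open>ln\<close>, obtained from the tangent line at
  \<open>a\<close>.\<close>

lemma sum_ln_le_card_mult_ln:
  fixes x :: "'a \<Rightarrow> real" and a :: real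
  assumes "a > 0" "\<And>v. v \<in> X \<Longrightarrow> x v > 0" "sum x X \<le> card X * a"
  shows "(\<Sum>v\<in>X. ln (x v)) \<le> card X * ln a"
proof -
  have "ln (x v) \<le> ln a + (x v / a - 1)" if "v \<in> X" for v
    using ln_le_minus_one[of "x v / a"] assms(1) assms(2)[OF that] by (simp add: ln_div)
  then have "(\<Sum>v\<in>X. ln (x v)) \<le> (\<Sum>v\<in>X. ln a + (x v / a - 1))" by (rule sum_mono)
  also have "\<dots> = card X * ln a + (sum x X / a - card X)"
    by (simp add: sum.distrib sum_subtractf sum_divide_distrib)
  also have "\<dots> \<le> card X * ln a" using assms by (simp add: field_simps)
  finally show ?thesis .
qed

lemma power_self_le_fact_squared: "n ^ n \<le> (fact n :: nat)\<^sup>2"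
proof -
  have "n ^ n = (\<Prod>i\<in>{1..n}. n)" by simp
  also have "\<dots> \<le> (\<Prod>i\<in>{1..n}. i * (n + 1 - i))"
  proof (rule prod_mono)
    fix i assume "i \<in> {1..n}"
    \<comment> \<open>With these,
      \<open>i * (n + 1 - i) = (j + 1) * (k + 1) \<ge> j + k + 1 = n\<close>.\<close>
    then obtain j k where "i = Suc j" "n = Suc j + k" by (auto dest!: le_Suc_ex Suc_le_D)
    then show "0 \<le> n \<and> n \<le> i * (n + 1 - i)" by simp
  qed
  also have "\<dots> = (\<Prod>i\<in>{1..n}. i) * (\<Prod>i\<in>{1..n}. n + 1 - i)" by (rule prod.distrib)
  also have "(\<Prod>i\<in>{1..n}. n + 1 - i) = (\<Prod>i\<in>{1..n}. i)"
    using prod.atLeastAtMost_rev[of "\<lambda>i. i" 1 n] by (simp add: add.commute)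
  finally show ?thesis by (simp add: fact_prod power2_eq_square)
qed

lemma two_power_le_fact_Suc: "2 ^ n \<le> (fact (Suc n) :: nat)"
proof (induction n)
  case (Suc n)
  have "2 * 2 ^ n \<le> (Suc (Suc n)) * (fact (Suc n) :: nat)"
    using Suc by (intro mult_mono) auto
  then show ?case by simp
qed simp

text \<open>Each factor is at most \<open>(deg v + 2)\<^sup>2\<close>. The degrees sum to at most
  \<open>card X * a / 24\<close>, and \<open>a / 24 + 2 \<le> a\<close> because
  \<open>a \<ge> 3\<close>, so Jensen applies with mean \<open>a\<close>.\<close>

lemma log_card_agreeing_orders_le:
  fixes a :: real
  assumes "finite X" "finite E" "a \<ge> 3" "real (card E) \<le> 1 / 48 * (card X * a)"
    and f: "\<forall>v\<in>X. f v \<le> card (incident E v)" and L: "linear_order_on X L"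
  shows "log 2 (card (agreeing_orders X f L)) \<le> 2 * card X * log 2 a"
proof -
  let ?d = "\<lambda>v. real (card (incident E v)) + 2"
  let ?k = "card (agreeing_orders X f L)"
  have "L \<in> agreeing_orders X f L" using L by (simp add: agreeing_orders_def)
  moreover have "finite (agreeing_orders X f L)"
    by (rule finite_subset[OF _ finite_linear_orders[OF assms(1)]]) (auto simp: agreeing_orders_def)
  ultimately have pos: "?k > 0" by (auto simp: card_gt_0_iff)
  have "real ?k \<le> (\<Prod>v\<in>X. (real (f v) + 1) * (real (f v) + 2))"
    by (rule card_agreeing_orders_le[OF assms(1)])
  also have "\<dots> \<le> (\<Prod>v\<in>X. (?d v)\<^sup>2)"
    unfolding power2_eq_square using f by (intro prod_mono conjI mult_mono) force+
  finally have "ln ?k \<le> ln (\<Prod>v\<in>X. (?d v)\<^sup>2)" using pos by simp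
  also have "\<dots> = (\<Sum>v\<in>X. ln ((?d v)\<^sup>2))"
    using assms(1) by (intro ln_prod) (auto simp: add_nonneg_pos)
  also have "\<dots> = 2 * (\<Sum>v\<in>X. ln (?d v))"
    by (simp add: ln_realpow add_nonneg_pos sum_distrib_left)
  also have "\<dots> \<le> 2 * (card X * ln a)"
  proof -
    have "sum ?d X = real (\<Sum>v\<in>X. card (incident E v)) + 2 * card X"
      by (simp add: sum.distrib)
    also have "\<dots> \<le> 2 * card E + 2 * card X"
      using sum_card_incident_le[OF assms(2,1)] by linarith
    also have "\<dots> \<le> 1 / 24 * (card X * a) + 2 * card X" using assms(4) by simp
    also have "\<dots> = card X * (a / 24 + 2)" by (simp add: algebra_simps)
    also have "\<dots> \<le> card X * a" using assms(3) by (intro mult_left_mono) auto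
    finally have "(\<Sum>v\<in>X. ln (?d v)) \<le> card X * ln a"
      using assms(3) by (intro sum_ln_le_card_mult_ln) (auto intro: add_nonneg_pos)
    then show ?thesis by simp
  qed
  finally show ?thesis by (simp add: log_def field_simps)
qed

section \<open>The lower bound for two-phase sorting\<close>

theorem theorem2:
  fixes c :: real and n :: nat and X :: "'a set"
  assumes "c \<ge> 3" and "n \<ge> 2" and "finite X" and "card X = n"
  shows "\<not> (\<exists>A :: 'a two_phase_alg. valid_alg X A \<and>
    (\<forall>P. partial_order_on X P \<longrightarrow>
       real (num_queries (strict_oracle P) A) \<le> 1 / 48 * real n powr (1 + 1 / c) \<and>
       (\<forall>L \<in> linear_extensions X P.
          run (strict_oracle L) (run (strict_oracle P) A) = L \<and>
          real (num_queries (strict_oracle L) (run (strict_oracle P) A))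
            \<le> 1 / 73 * c * log 2 (real (num_linear_extensions X P)))))"
proof clarify
  fix A :: "'a two_phase_alg"
  assume *: "\<forall>P. partial_order_on X P \<longrightarrow>
       real (num_queries (strict_oracle P) A) \<le> 1 / 48 * real n powr (1 + 1 / c) \<and>
       (\<forall>L \<in> linear_extensions X P.
          run (strict_oracle L) (run (strict_oracle P) A) = L \<and>
          real (num_queries (strict_oracle L) (run (strict_oracle P) A))
            \<le> 1 / 73 * c * log 2 (real (num_linear_extensions X P)))"
  define a where "a = real n powr (1 / c)"
  have na: "real n powr (1 + 1 / c) = n * a" using assms by (simp add: a_def powr_add)
  have sort: "run (strict_oracle L) (run (strict_oracle P) A) = L"
    and cost: "real (num_queries (strict_oracle L) (run (strict_oracle P) A))
      \<le> 1 / 73 * c * log 2 (card (linear_extensions X P))"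
    if "partial_order_on X P" "L \<in> linear_extensions X P" for P L
    using * that by (auto simp: num_linear_extensions_def)
  have pre: "real (num_queries (strict_oracle P) A) \<le> 1 / 48 * (n * a)"
    if "partial_order_on X P" for P
    using * that na by simp
  show False
  proof (cases "a < 3")
    case True
    \<comment> \<open>The exponent comes from \<open>n * a / 48 < n * 3 / 48 = n / 16\<close>. On a
      chain the query phase is a bare \<open>Return\<close>, so running it on any oracle, here the
      constant no, decodes the order.\<close>
    have "fact (card X) \<le> (2::nat) ^ (n div 16)"
    proof (rule fact_le_of_sorting[OF assms(3), where g = "run (\<lambda>_ _. False)" and B = A])
      fix L assume L: "linear_order_on X L"
      then have P: "partial_order_on X L" by (simp add: linear_order_on_def)
      have "num_queries (strict_oracle L) (run (strict_oracle L) A) = 0"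
        using cost[OF P] linear_extensions_linear_order[OF L] by simp
      then obtain r where "run (strict_oracle L) A = Return r"
        by (cases "run (strict_oracle L) A") auto
      then show "run (\<lambda>_ _. False) (run (strict_oracle L) A) = L"
        using sort[OF P, of L] linear_extensions_linear_order[OF L] by simp
      have "real n * a \<le> real n * 3" using True by (intro mult_left_mono) auto
      then have "real (num_queries (strict_oracle L) A) \<le> n / 16" using pre[OF P] by simp
      then show "num_queries (strict_oracle L) A \<le> n div 16" by linarith
    qed
    moreover have "2 ^ (n - 1) \<le> (fact n :: nat)"
      using two_power_le_fact_Suc[of "n - 1"] assms(2) by simp
    ultimately have "(2::nat) ^ (n - 1) \<le> 2 ^ (n div 16)" using assms(4) by (metis order_trans)
    then have "n - 1 \<le> n div 16" by simp
    then show False using assms(2) by linarith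
  next
    case False
    define E where "E = all_no_queries A"
    define B where "B = run (\<lambda>_ _. False) A"
    have "finite E" by (simp add: E_def finite_all_no_queries)
    then obtain f where f: "\<forall>v\<in>X. f v \<le> card (incident E v)"
      and proper: "\<forall>x\<in>X. \<forall>y\<in>X. (x, y) \<in> E \<longrightarrow> x \<noteq> y \<longrightarrow> f x \<noteq> (f y :: nat)"
      using greedy_colouring[OF _ assms(3)] by blast
    have consistent: "run (strict_oracle (monochromatic_part f L)) A = B"
      "num_queries (strict_oracle (monochromatic_part f L)) A = num_queries (\<lambda>_ _. False) A"
      if "linear_order_on X L" for L
    proof -
      \<comment> \<open>Queried pairs of distinct elements of \<open>X\<close> have different
        colours; on all other pairs the strict oracle says no anyway.\<close>
      have no: "\<not> strict_oracle (monochromatic_part f L) x y" if "(x, y) \<in> all_no_queries A" for x y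
        using that proper linear_order_on_subset[OF \<open>linear_order_on X L\<close>]
        by (auto simp: strict_oracle_def monochromatic_part_def E_def)
      show "run (strict_oracle (monochromatic_part f L)) A = B"
        "num_queries (strict_oracle (monochromatic_part f L)) A = num_queries (\<lambda>_ _. False) A"
        unfolding B_def using no by (auto intro: run_all_no)
    qed
    have ext: "L \<in> linear_extensions X (monochromatic_part f L)" if "linear_order_on X L" for L
      using that by (auto simp: linear_extensions_def monochromatic_part_def)
    \<comment> \<open>This removes \<open>c\<close> from the query bound:
      \<open>c / 73 * (2 * n * log 2 a)\<close> becomes
      \<open>2 / 73 * (n * log 2 n)\<close>.\<close>
    have ca: "c * log 2 a = log 2 n" using assms(1,2) by (simp add: a_def log_powr)
    define D where "D = nat \<lfloor>2 / 73 * (n * log 2 n)\<rfloor>"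
    have log_pos: "n * log 2 n > 0" using assms(2) by simp
    then have D: "real D \<le> 2 / 73 * (n * log 2 n)" unfolding D_def by linarith
    have "fact (card X) \<le> (2::nat) ^ D"
    proof (rule fact_le_of_sorting[OF assms(3), where g = "\<lambda>L. L" and B = B])
      fix L assume L: "linear_order_on X L"
      note P = partial_order_on_monochromatic_part[OF L, of f]
      show "run (strict_oracle L) B = L" using sort[OF P ext[OF L]] consistent[OF L] by simp
      have "real (card E) \<le> 1 / 48 * (card X * a)"
        using card_all_no_queries[of A] pre[OF P] consistent(2)[OF L] assms(4) by (simp add: E_def)
      then have "log 2 (card (agreeing_orders X f L)) \<le> 2 * n * log 2 a"
        using log_card_agreeing_orders_le[OF assms(3) \<open>finite E\<close> _ _ f L] False assms(4) by simp
      then have "1 / 73 * c * log 2 (card (agreeing_orders X f L)) \<le> 1 / 73 * c * (2 * n * log 2 a)"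
        using assms(1) by (intro mult_left_mono) auto
      also have "\<dots> = 2 / 73 * (n * (c * log 2 a))" by simp
      finally have "real (num_queries (strict_oracle L) B) \<le> 2 / 73 * (n * log 2 n)"
        using cost[OF P ext[OF L]] consistent(1)[OF L] linear_extensions_monochromatic_part[OF L, of f]
        unfolding ca by simp
      then show "num_queries (strict_oracle L) B \<le> D" unfolding D_def by linarith
    qed
    \<comment> \<open>Since \<open>n ^ n \<le> (fact n)\<^sup>2\<close>, squaring leads to
      \<open>n * log 2 n \<le> 2 * D \<le> 4 / 73 * (n * log 2 n)\<close>, impossible for a positive
      quantity.\<close>
    then have "(fact n)\<^sup>2 \<le> ((2::nat) ^ D)\<^sup>2" using assms(4) by (simp add: power_mono)
    then have "n ^ n \<le> (2::nat) ^ (D * 2)"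
      using power_self_le_fact_squared[of n] unfolding power_mult by (rule order_trans[rotated])
    then have "real n ^ n \<le> 2 ^ (D * 2)"
      by (metis of_nat_le_iff of_nat_numeral of_nat_power)
    then have "log 2 (real n ^ n) \<le> log 2 (2 ^ (D * 2))"
      using assms(2) by (subst log_le_cancel_iff) auto
    then have "n * log 2 n \<le> D * 2" using assms(2) by (simp add: log_nat_power)
    with D log_pos show False by simp
  qed
qed

end
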